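(* Consider a main effect plan with set of factors $\mathcal{F}$ and $n$ runs, under the normal linear model $Y\sim N_n\big(\sum_{B\in\mathcal{F}}X_B\alpha^B,\ \sigma^2 I_n\big)$. Fix $A\in\mathcal{F}$, put $\bar A=\mathcal{F}\setminus\{A\}$, and let $\bar A=S\cup T$ with $S\cap T=\emptyset$. Then the condition $$X_A'(I-P_T)X_B=0\quad\text{for every } B\in S$$ (that is, $A$ is orthogonal to $B$ through $T$ for all $B\in S$) is necessary and sufficient for each of the following two statements: (a) $C_{A;T}$ is the C-matrix of $A$, i.e. $C_A=C_{A;T}$; (b) $SS_{A;\bar A}=SS_{A;T}$ with probability $1$.
   Context: A main effect plan has a finite set $\mathcal{F}$ of factors; factor $A\in\mathcal{F}$ has a finite level set $S_A$ with $s_A=|S_A|$. The general effect is viewed as a factor $G\in\mathcal{F}$ with $s_G=1$. A plan with $n$ runs assigns to each run a level of each factor. The design matrix $X_A$ of $A$ is the $n\times s_A$ matrix with $(u,t)$ entry $1$ if in run $u$ the factor $A$ is at level $t$, and $0$ otherwise; in particular $X_G=1_n$ (all-ones vector). The vector $\alpha^A\in\mathbb{R}^{s_A}$ is the unknown vector of effects of $A$, $Y$ is the $n\times1$ vector of responses, and $\sigma^2>0$. For a matrix $M$, $P_M$ denotes the orthogonal projector onto the column space of $M$. For $T\subseteq\mathcal{F}$, $X_T=[X_B: B\in T]$ is the matrix obtained by placing the $X_B$ side by side, and $P_T=P_{X_T}$. For $A\notin T$ put $C_{A;T}=X_A'(I-P_T)X_A$ and $Q_{A;T}=X_A'(I-P_T)Y$.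 The C-matrix of $A$ is $C_A=C_{A;\bar A}$. The sum of squares for $A$ adjusted for the factors in $T$ is $SS_{A;T}=Q_{A;T}'\,(C_{A;T})^{-}\,Q_{A;T}$, where $^-$ denotes a generalized inverse; equivalently $SS_{A;T}=Y'P_VY$ with $V=(I-P_T)X_A$. Factors $A,B\notin T$ are said to be orthogonal through $T$ (written $A\perp_T B$) if $X_A'(I-P_T)X_B=0$. Standing assumption: only connected plans are considered, i.e. $\mathrm{rank}(C_A)=s_A-1$ for every $A\in\mathcal{F}$. *)

theory Defs
  imports "HOL-Probability.Probability"
begin

text \<open>
  Conventions. The set of factors is a finite type \<open>'f\<close>, so the complement of \<open>A\<close> in it is
  \<open>- {A}\<close>; runs are indexed by a finite type \<open>'n\<close>. The level sets \<open>lev A\<close> may differ in size and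
  are subsets of one finite type \<open>'l\<close>. A matrix with \<open>s\<^sub>A\<close> rows or columns is therefore indexed by
  all of \<open>'l\<close>; since runs only take levels in \<open>lev A\<close>, the entries with an index outside
  \<open>lev A\<close> are zero. This padding does not affect column spaces, ranks, products, equality of
  the matrices below, or the sums of squares; likewise the coordinates of an effect vector
  outside \<open>lev A\<close> do not enter the model.
\<close>

definition main_effect_plan ::
    "('f::finite \<Rightarrow> 'l::finite set) \<Rightarrow> ('n::finite \<Rightarrow> 'f \<Rightarrow> 'l) \<Rightarrow> 'f \<Rightarrow> bool" where
  "main_effect_plan lev run G \<longleftrightarrow> (\<forall>u A. run u A \<in> lev A) \<and> card (lev G) = 1"

definition design :: "('n::finite \<Rightarrow> 'f::finite \<Rightarrow> 'l::finite) \<Rightarrow> 'f \<Rightarrow> real^'l^'n" where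
  "design run A = (\<chi> u t. if run u A = t then 1 else 0)"

text \<open>The columns with index \<open>(B, t)\<close>, \<open>B \<notin> T\<close>, are zero padding.\<close>

definition joint_design ::
    "('n::finite \<Rightarrow> 'f::finite \<Rightarrow> 'l::finite) \<Rightarrow> 'f set \<Rightarrow> real^('f \<times> 'l)^'n" where
  "joint_design run T = (\<chi> u p. if fst p \<in> T then design run (fst p) $ u $ snd p else 0)"

definition is_projector :: "real^'m^'n \<Rightarrow> real^'n^'n \<Rightarrow> bool" where
  "is_projector M P \<longleftrightarrow>
     (\<forall>y. P *v y \<in> span (columns M) \<and> (\<forall>z \<in> span (columns M). (y - P *v y) \<bullet> z = 0))"

definition projector :: "real^'m^'n \<Rightarrow> real^'n^'n" where
  "projector M = (THE P. is_projector M P)"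

lemma ex1_projector: "\<exists>!P. is_projector M P"
proof -
  let ?V = "span (columns M)"
  have uniq: "p = q"
    if "p \<in> ?V" "q \<in> ?V" "\<forall>z\<in>?V. (y - p) \<bullet> z = 0" "\<forall>z\<in>?V. (y - q) \<bullet> z = 0" for p q y
  proof -
    have "p - q \<in> ?V" using that by (simp add: span_diff)
    then have "(y - q) \<bullet> (p - q) - (y - p) \<bullet> (p - q) = 0" using that by simp
    then have "(p - q) \<bullet> (p - q) = 0" by (simp add: inner_diff_left)
    then show ?thesis by simp
  qed
  have "\<exists>p. p \<in> ?V \<and> (\<forall>z\<in>?V. (y - p) \<bullet> z = 0)" for y
  proof -
    obtain p q where "p \<in> ?V" "\<And>z. z \<in> ?V \<Longrightarrow> orthogonal q z" "y = p + q"
      using orthogonal_subspace_decomp_exists[of "columns M" y] by metis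
    then show ?thesis by (auto simp: orthogonal_def intro!: exI[of _ p])
  qed
  then obtain f where f: "\<And>y. f y \<in> ?V" "\<And>y z. z \<in> ?V \<Longrightarrow> (y - f y) \<bullet> z = 0" by metis
  have "linear f"
  proof (rule linearI)
    fix x y and c :: real
    have "(x + y - (f x + f y)) \<bullet> z = (x - f x) \<bullet> z + (y - f y) \<bullet> z" for z
      by (simp add: algebra_simps)
    then show "f (x + y) = f x + f y"
      by (intro uniq[where y = "x + y"]) (auto simp: f span_add)
    have "(c *\<^sub>R x - c *\<^sub>R f x) \<bullet> z = c * ((x - f x) \<bullet> z)" for z
      by (simp add: algebra_simps)
    then show "f (c *\<^sub>R x) = c *\<^sub>R f x"
      by (intro uniq[where y = "c *\<^sub>R x"]) (auto simp: f span_scale)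
  qed
  then have "is_projector M (matrix f)"
    by (simp add: is_projector_def f matrix_works linear_matrix_vector_mul_eq)
  moreover have "P = P'" if "is_projector M P" "is_projector M P'" for P P'
    unfolding matrix_eq
  proof
    fix y
    show "P *v y = P' *v y"
      using that unfolding is_projector_def by (intro uniq[where y = y]) auto
  qed
  ultimately show ?thesis by blast
qed

definition C_adj ::
    "('n::finite \<Rightarrow> 'f::finite \<Rightarrow> 'l::finite) \<Rightarrow> 'f \<Rightarrow> 'f set \<Rightarrow> real^'l^'l" where
  "C_adj run A T =
     transpose (design run A) ** (mat 1 - projector (joint_design run T)) ** design run A"

definition C_matrix :: "('n::finite \<Rightarrow> 'f::finite \<Rightarrow> 'l::finite) \<Rightarrow> 'f \<Rightarrow> real^'l^'l" where
  "C_matrix run A = C_adj run A (- {A})"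

definition connected_plan ::
    "('f::finite \<Rightarrow> 'l::finite set) \<Rightarrow> ('n::finite \<Rightarrow> 'f \<Rightarrow> 'l) \<Rightarrow> bool" where
  "connected_plan lev run \<longleftrightarrow> (\<forall>A. rank (C_matrix run A) = card (lev A) - 1)"

definition Q_adj ::
    "('n::finite \<Rightarrow> 'f::finite \<Rightarrow> 'l::finite) \<Rightarrow> 'f \<Rightarrow> 'f set \<Rightarrow> real^'n \<Rightarrow> real^'l" where
  "Q_adj run A T y =
     (transpose (design run A) ** (mat 1 - projector (joint_design run T))) *v y"

text \<open>The sum of squares does not depend on which generalized inverse is chosen.\<close>

definition ginverse :: "real^'m^'n \<Rightarrow> real^'n^'m" where
  "ginverse C = (SOME H. C ** H ** C = C)"

lemma ginverse: "C ** ginverse C ** C = C"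
proof -
  obtain g where "linear g" and g: "\<And>v. v \<in> range ((*v) C) \<Longrightarrow> C *v g v = v"
    using linear_exists_right_inverse_on[of "(*v) C" UNIV] by auto
  then have "C ** matrix g ** C = C"
    unfolding matrix_eq by (simp add: matrix_vector_mul_assoc[symmetric] matrix_works)
  then show ?thesis unfolding ginverse_def by (rule someI)
qed

definition SS_adj ::
    "('n::finite \<Rightarrow> 'f::finite \<Rightarrow> 'l::finite) \<Rightarrow> 'f \<Rightarrow> 'f set \<Rightarrow> real^'n \<Rightarrow> real" where
  "SS_adj run A T y = Q_adj run A T y \<bullet> (ginverse (C_adj run A T) *v Q_adj run A T y)"

definition orthogonal_through ::
    "('n::finite \<Rightarrow> 'f::finite \<Rightarrow> 'l::finite) \<Rightarrow> 'f \<Rightarrow> 'f set \<Rightarrow> 'f \<Rightarrow> bool" where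
  "orthogonal_through run A T B \<longleftrightarrow>
     transpose (design run A) ** (mat 1 - projector (joint_design run T)) ** design run B = 0"

text \<open>Intended for a positive definite covariance matrix \<open>\<Sigma>\<close> only.\<close>

definition mvnormal_density :: "real^'n \<Rightarrow> real^'n^'n \<Rightarrow> real^'n \<Rightarrow> real" where
  "mvnormal_density \<mu> \<Sigma> y =
     exp (- ((y - \<mu>) \<bullet> (matrix_inv \<Sigma> *v (y - \<mu>))) / 2) /
       sqrt ((2 * pi) ^ CARD('n) * det \<Sigma>)"

definition normal_linear_model ::
    "('n::finite \<Rightarrow> 'f::finite \<Rightarrow> 'l::finite) \<Rightarrow> ('f \<Rightarrow> real^'l) \<Rightarrow> real \<Rightarrow>
     'w measure \<Rightarrow> ('w \<Rightarrow> real^'n) \<Rightarrow> bool" where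
  "normal_linear_model run \<alpha> \<sigma> M Y \<longleftrightarrow>
     prob_space M \<and>
     distributed M lborel Y
       (\<lambda>y. ennreal (mvnormal_density (\<Sum>B\<in>UNIV. design run B *v \<alpha> B) (\<sigma>\<^sup>2 *\<^sub>R mat 1) y))"

end

theory Submission
  imports Defs
begin

text \<open>
  Write \<open>R\<^sub>T = I - P\<^sub>T\<close> and let \<open>U\<close> be the set of all factors other than \<open>A\<close>. Both parts of the
  theorem say that going from \<open>T\<close> to the larger set \<open>U\<close> changes nothing for \<open>A\<close>, and each is
  equivalent to one matrix identity, \<open>R\<^sub>U X\<^sub>A = R\<^sub>T X\<^sub>A\<close>.

  Orthogonality through \<open>T\<close> is this identity (\<open>cross_residual_zero_iff_residual_eq\<close>). The
  condition says that the columns of \<open>R\<^sub>T X\<^sub>A\<close> are orthogonal to those of \<open>X\<^sub>B\<close> for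
  all \<open>B\<close> in \<open>S\<close>. They are orthogonal to those of \<open>X\<^sub>T\<close> in any case, hence to all of \<open>X\<^sub>U\<close>, so
  adjusting them further for \<open>U\<close> leaves them as they are; and adjusting for \<open>T\<close> and then for
  \<open>U\<close> is the same as adjusting for \<open>U\<close> at once.

  For the C-matrix (\<open>gram_residual_eq_iff\<close>), note that \<open>C\<^sub>A\<^sub>;\<^sub>T\<close> is the Gram matrix of
  \<open>R\<^sub>T X\<^sub>A\<close>. Equality of the two Gram matrices means that the further adjustment
  shortens no vector \<open>R\<^sub>T X\<^sub>A x\<close>; a projector that preserves the length of a vector fixes it.

  For the sum of squares (\<open>SS_adj_eq_iff\<close>), use that \<open>SS\<^sub>A\<^sub>;\<^sub>T\<close> is the squared length of the
  projection of \<open>Y\<close> onto the column space of \<open>R\<^sub>T X\<^sub>A\<close>. The response has a density that is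
  positive everywhere and sums of squares are continuous in it, so almost sure equality is
  equality at every response vector (\<open>normal_linear_model_AE_iff\<close>). A response in the column space
  of \<open>X\<^sub>U\<close> has sum of squares zero after adjustment for \<open>U\<close>; if it is also zero after
  adjustment for \<open>T\<close>, then that response is orthogonal to \<open>R\<^sub>T X\<^sub>A\<close>. As this holds for every
  column of \<open>X\<^sub>U\<close>, it is the orthogonality condition.
\<close>

section \<open>Projectors and residual operators\<close>

lemma span_columns_eq_range: "span (columns (M :: real^'m^'n)) = range ((*v) M)"
proof
  show "span (columns M) \<subseteq> range ((*v) M)"
  proof (rule span_minimal)
    show "columns M \<subseteq> range ((*v) M)"
      by (auto simp: columns_def matrix_vector_mult_basis[symmetric])
    show "subspace (range ((*v) M))"
      by (rule linear_subspace_image) auto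
  qed
  show "range ((*v) M) \<subseteq> span (columns M)"
    using matrix_vector_mult_in_columnspace by blast
qed

lemma inner_transpose: "x \<bullet> (transpose M *v y) = (M *v x) \<bullet> y" for M :: "real^'m^'n"
  by (metis dot_lmul_matrix inner_commute transpose_matrix_vector)

lemma is_projector_projector: "is_projector M (projector M)"
  unfolding projector_def by (rule theI'[OF ex1_projector])

lemma projector_in_columnspace: "projector M *v y \<in> span (columns M)"
  using is_projector_projector[of M] by (simp add: is_projector_def)

definition residual_maker :: "real^'m^'n \<Rightarrow> real^'n^'n" where
  "residual_maker M = mat 1 - projector M"

lemma residual_maker_apply: "residual_maker M *v y = y - projector M *v y"
  by (simp add: residual_maker_def matrix_vector_mult_diff_rdistrib)

lemma residual_orthogonal:
  assumes "z \<in> span (columns M)"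
  shows "(residual_maker M *v y) \<bullet> z = 0"
  using is_projector_projector[of M] assms by (simp add: is_projector_def residual_maker_apply)

text \<open>
  Splitting either argument into its projection and its residual, the mixed terms vanish and both
  sides become the inner product of the two residuals.
\<close>

lemma inner_residual_commute:
  "(residual_maker M *v x) \<bullet> y = x \<bullet> (residual_maker M *v y)"
proof -
  let ?R = "residual_maker M"
  have "(?R *v x) \<bullet> y = (?R *v x) \<bullet> (?R *v y) + (?R *v x) \<bullet> (projector M *v y)"
    by (simp add: residual_maker_apply inner_diff_right)
  also have "(?R *v x) \<bullet> (projector M *v y) = 0"
    by (intro residual_orthogonal projector_in_columnspace)
  also have "(0::real) = (?R *v y) \<bullet> (projector M *v x)"
    by (intro residual_orthogonal[symmetric] projector_in_columnspace)
  also have "(?R *v x) \<bullet> (?R *v y) + (?R *v y) \<bullet> (projector M *v x) = x \<bullet> (?R *v y)"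
    by (simp add: residual_maker_apply inner_diff_left inner_diff_right inner_commute)
  finally show ?thesis .
qed

lemma transpose_residual_maker: "transpose (residual_maker M) = residual_maker M"
proof -
  have "transpose (residual_maker M) *v y = residual_maker M *v y" for y
    by (rule vector_eq_ldot[THEN iffD1])
       (simp add: inner_transpose inner_residual_commute del: transpose_matrix_vector)
  then show ?thesis by (simp add: matrix_eq)
qed

lemma residual_columnspace:
  assumes "z \<in> span (columns M)"
  shows "residual_maker M *v z = 0"
proof -
  have "residual_maker M *v z \<in> span (columns M)"
    using assms by (simp add: residual_maker_apply span_diff projector_in_columnspace)
  then have "(residual_maker M *v z) \<bullet> (residual_maker M *v z) = 0"
    by (rule residual_orthogonal)
  then show ?thesis by simp
qed

text \<open>
  The part removed by the first adjustment lies in the smaller column space, so the second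
  adjustment would have removed it anyway.
\<close>

lemma residual_maker_nested:
  assumes "span (columns N) \<subseteq> span (columns N')"
  shows "residual_maker N' ** residual_maker N = residual_maker N'"
proof -
  have "residual_maker N' *v (residual_maker N *v y) = residual_maker N' *v y" for y
  proof -
    have "projector N *v y \<in> span (columns N')"
      using assms projector_in_columnspace by blast
    then have "residual_maker N' *v (projector N *v y) = 0"
      by (rule residual_columnspace)
    then show ?thesis
      by (simp add: residual_maker_apply[of N] matrix_vector_mult_diff_distrib)
  qed
  then show ?thesis by (simp add: matrix_eq matrix_vector_mul_assoc)
qed

lemma residual_maker_mult_self: "residual_maker M ** M = 0"
  using residual_columnspace[of _ M]
  by (simp add: matrix_eq matrix_vector_mul_assoc[symmetric] matrix_vector_mult_in_columnspace)

lemma transpose_residual_mult: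
  "transpose (residual_maker N ** X) = transpose X ** residual_maker N"
  by (simp add: matrix_transpose_mul transpose_residual_maker)

lemma transpose_mult_residual_maker: "transpose M ** residual_maker M = 0"
  by (simp add: transpose_residual_mult[symmetric] residual_maker_mult_self)
     (simp add: transpose_def vec_eq_iff)

section \<open>Adjusting for a larger set of factors\<close>

text \<open>
  A column of \<open>V\<close> has projection zero: the projection lies in the column space of \<open>N\<close>, so it
  is orthogonal both to the column and to its residual, hence to their difference, which
  is the projection itself.
\<close>

lemma residual_maker_fixes_orthogonal:
  assumes "transpose V ** N = 0"
  shows "residual_maker N ** V = V"
proof -
  have "residual_maker N *v (V *v x) = V *v x" for x
  proof -
    let ?p = "projector N *v (V *v x)"
    obtain k where k: "?p = N *v k"
      using projector_in_columnspace[of N "V *v x"] by (auto simp: span_columns_eq_range)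
    have "(V *v x) \<bullet> ?p = x \<bullet> ((transpose V ** N) *v k)"
      by (simp add: k matrix_vector_mul_assoc[symmetric] inner_transpose
          del: transpose_matrix_vector)
    then have "(V *v x) \<bullet> ?p = 0" by (simp add: assms)
    moreover have "(residual_maker N *v (V *v x)) \<bullet> ?p = 0"
      by (intro residual_orthogonal projector_in_columnspace)
    ultimately have "?p \<bullet> ?p = 0"
      by (simp add: residual_maker_apply inner_diff_left)
    then show ?thesis by (simp add: residual_maker_apply)
  qed
  then show ?thesis by (simp add: matrix_eq matrix_vector_mul_assoc)
qed

text \<open>
  The link between the orthogonality condition and everything else. Forwards, the matrix
  \<open>residual_maker N ** X\<close> is orthogonal to \<open>N'\<close>, so a second adjustment, for \<open>N'\<close>, does not change
  it, and nested adjustments collapse to the one for \<open>N'\<close>. Backwards, \<open>N\<close> may be replaced by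
  \<open>N'\<close> in the product, and \<open>residual_maker N'\<close> annihilates \<open>N'\<close>.
\<close>

lemma cross_residual_zero_iff_residual_eq:
  assumes "span (columns N) \<subseteq> span (columns N')"
  shows "transpose X ** residual_maker N ** N' = 0 \<longleftrightarrow>
         residual_maker N' ** X = residual_maker N ** X"
proof
  assume "transpose X ** residual_maker N ** N' = 0"
  then have "residual_maker N' ** (residual_maker N ** X) = residual_maker N ** X"
    by (intro residual_maker_fixes_orthogonal) (simp add: transpose_residual_mult)
  then show "residual_maker N' ** X = residual_maker N ** X"
    by (simp add: matrix_mul_assoc residual_maker_nested[OF assms])
next
  assume "residual_maker N' ** X = residual_maker N ** X"
  then have "transpose X ** residual_maker N ** N' = transpose X ** residual_maker N' ** N'"
    by (metis transpose_residual_mult)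
  then show "transpose X ** residual_maker N ** N' = 0"
    by (simp add: matrix_mul_assoc[symmetric] residual_maker_mult_self)
qed

text \<open>
  Since the residual operator is symmetric and idempotent, an adjusted cross product matrix is a
  Gram matrix. Its quadratic form is therefore a squared length.
\<close>

lemma residual_gram:
  "transpose X ** residual_maker N ** X =
   transpose (residual_maker N ** X) ** (residual_maker N ** X)"
proof -
  have "residual_maker N ** residual_maker N = residual_maker N"
    by (rule residual_maker_nested) simp
  then show ?thesis
    by (simp add: transpose_residual_mult) (metis matrix_mul_assoc)
qed

lemma inner_gram: "x \<bullet> ((transpose V ** V) *v x) = (norm (V *v x))\<^sup>2" for V :: "real^'m^'n"
  by (simp add: power2_norm_eq_inner matrix_vector_mul_assoc[symmetric] inner_transpose
      del: transpose_matrix_vector)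

lemma residual_norm_sq:
  "(norm (residual_maker M *v y))\<^sup>2 + (norm (projector M *v y))\<^sup>2 = (norm y)\<^sup>2"
proof -
  have "(residual_maker M *v y) \<bullet> (projector M *v y) = 0"
    by (intro residual_orthogonal projector_in_columnspace)
  then have "(norm (residual_maker M *v y + projector M *v y))\<^sup>2 =
      (norm (residual_maker M *v y))\<^sup>2 + (norm (projector M *v y))\<^sup>2"
    by (simp add: power2_norm_eq_inner algebra_simps inner_commute)
  then show ?thesis by (simp add: residual_maker_apply)
qed

text \<open>
  Going from \<open>N\<close> to \<open>N'\<close> replaces \<open>residual_maker N ** X\<close> by its own residual. By Pythagoras
  its columns lose exactly the squared length of their projections, so Gram matrices can
  agree only if those projections vanish.
\<close>

lemma gram_residual_eq_iff:
  assumes "span (columns N) \<subseteq> span (columns N')"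
  shows "transpose X ** residual_maker N' ** X = transpose X ** residual_maker N ** X \<longleftrightarrow>
         residual_maker N' ** X = residual_maker N ** X"
proof
  assume eq: "transpose X ** residual_maker N' ** X = transpose X ** residual_maker N ** X"
  have "residual_maker N' *v (X *v x) = residual_maker N *v (X *v x)" for x
  proof -
    let ?r = "residual_maker N *v (X *v x)" and ?r' = "residual_maker N' *v (X *v x)"
    have r': "residual_maker N' *v ?r = ?r'"
      by (metis matrix_vector_mul_assoc residual_maker_nested[OF assms])
    have "(norm ?r')\<^sup>2 = (norm ?r)\<^sup>2"
      using arg_cong[OF eq, of "\<lambda>C. x \<bullet> (C *v x)"]
      by (simp add: residual_gram inner_gram matrix_vector_mul_assoc)
    then have "projector N' *v ?r = 0"
      using residual_norm_sq[of N' ?r] by (simp add: r')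
    then show ?thesis
      using r' by (simp add: residual_maker_apply[of N' ?r])
  qed
  then show "residual_maker N' ** X = residual_maker N ** X"
    by (simp add: matrix_eq matrix_vector_mul_assoc)
next
  assume "residual_maker N' ** X = residual_maker N ** X"
  then show "transpose X ** residual_maker N' ** X = transpose X ** residual_maker N ** X"
    by (simp add: residual_gram)
qed

section \<open>Sums of squares\<close>

text \<open>
  The classical argument by normal equations: if \<open>V *v b\<close> is the projection of \<open>y\<close>, then
  \<open>transpose V *v y = C *v b\<close> with \<open>C = transpose V ** V\<close>. So the form is evaluated only on the
  range of \<open>C\<close>, where the defining equation of a generalized inverse reduces it to
  \<open>b \<bullet> (C *v b)\<close>, whatever the choice of the inverse.
\<close>

lemma ginverse_gram_form:
  fixes V :: "real^'m^'n"
  shows "(transpose V *v y) \<bullet> (ginverse (transpose V ** V) *v (transpose V *v y)) =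
         (norm (projector V *v y))\<^sup>2"
proof -
  let ?C = "transpose V ** V"
  obtain b where b: "projector V *v y = V *v b"
    using projector_in_columnspace[of V y] by (auto simp: span_columns_eq_range)
  have "transpose V *v (residual_maker V *v y) = 0"
    by (simp add: matrix_vector_mul_assoc transpose_mult_residual_maker del: transpose_matrix_vector)
  then have normal: "transpose V *v y = ?C *v b"
    by (simp add: residual_maker_apply b matrix_vector_mult_diff_distrib matrix_vector_mul_assoc
        del: transpose_matrix_vector)
  have "(?C *v b) \<bullet> (ginverse ?C *v (?C *v b)) = b \<bullet> (?C *v (ginverse ?C *v (?C *v b)))"
    by (simp add: adjoint_works[symmetric] adjoint_matrix matrix_transpose_mul inner_commute)
  also have "\<dots> = b \<bullet> (?C *v b)"
    by (metis ginverse matrix_vector_mul_assoc)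
  finally show ?thesis by (simp add: normal b inner_gram del: transpose_matrix_vector)
qed

lemma Q_adj_residual:
  "Q_adj run A T y = transpose (residual_maker (joint_design run T) ** design run A) *v y"
  by (simp add: Q_adj_def residual_maker_def[symmetric] transpose_residual_mult)

lemma C_adj_residual:
  "C_adj run A T = transpose (design run A) ** residual_maker (joint_design run T) ** design run A"
  by (simp add: C_adj_def residual_maker_def)

lemma SS_adj_eq_norm_sq:
  "SS_adj run A T y =
   (norm (projector (residual_maker (joint_design run T) ** design run A) *v y))\<^sup>2"
  unfolding SS_adj_def Q_adj_residual C_adj_residual residual_gram by (rule ginverse_gram_form)

text \<open>
  A vanishing sum of squares forces \<open>Q\<close> itself to vanish, as the response then equals
  its residual from the adjusted design matrix and is orthogonal to the columns of that matrix.
\<close>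

lemma SS_adj_eq_0_imp:
  assumes "SS_adj run A T y = 0"
  shows "Q_adj run A T y = 0"
proof -
  let ?V = "residual_maker (joint_design run T) ** design run A"
  have "residual_maker ?V *v y = y"
    using assms by (simp add: SS_adj_eq_norm_sq residual_maker_apply)
  moreover have "transpose ?V ** residual_maker ?V = 0"
    by (rule transpose_mult_residual_maker)
  ultimately show ?thesis
    by (metis Q_adj_residual matrix_vector_mul_assoc matrix_vector_mult_0)
qed

lemma continuous_SS_adj: "continuous_on UNIV (SS_adj run A T)"
  unfolding SS_adj_def[abs_def] Q_adj_def matrix_vector_mul_assoc
  by (intro continuous_intros)

section \<open>Almost sure statements\<close>

lemma mvnormal_density_pos:
  fixes y :: "real^'n"
  assumes "\<sigma> > 0"
  shows "mvnormal_density \<mu> (\<sigma>\<^sup>2 *\<^sub>R mat 1) y > 0"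
proof -
  have "det (\<sigma>\<^sup>2 *\<^sub>R mat 1 :: real^'n^'n) = (\<sigma>\<^sup>2) ^ CARD('n)"
    by (subst det_diagonal) (auto simp: mat_def)
  then show ?thesis
    using assms by (simp add: mvnormal_density_def)
qed

text \<open>
  The exceptional set is open, and a nonempty open set has positive Lebesgue measure.
\<close>

lemma AE_lborel_closed_iff:
  fixes P :: "'a::euclidean_space \<Rightarrow> bool"
  assumes "closed {y. P y}"
  shows "(AE y in lborel. P y) \<longleftrightarrow> (\<forall>y. P y)"
proof
  assume "AE y in lborel. P y"
  moreover have op: "open {y. \<not> P y}"
    using assms by (simp add: closed_def Collect_neg_eq)
  ultimately have "{y. \<not> P y} \<in> null_sets lborel"
    by (subst AE_iff_null_sets) auto
  then have "negligible {y. \<not> P y}"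
    by (metis negligible_iff_null_sets null_sets_completionI)
  then have "{y. \<not> P y} = {}"
    using op open_not_negligible by blast
  then show "\<forall>y. P y" by blast
qed simp

text \<open>
  As \<open>\<sigma> > 0\<close>, the density is positive everywhere, so the law of the response and Lebesgue measure
  have the same null sets.
\<close>

lemma normal_linear_model_AE_iff:
  assumes "normal_linear_model run \<alpha> \<sigma> M Y" and "\<sigma> > 0" and "closed {y. P y}"
  shows "(AE w in M. P (Y w)) \<longleftrightarrow> (\<forall>y. P y)"
proof -
  let ?f = "\<lambda>y. ennreal (mvnormal_density (\<Sum>B\<in>UNIV. design run B *v \<alpha> B) (\<sigma>\<^sup>2 *\<^sub>R mat 1) y)"
  have D: "distributed M lborel Y ?f"
    using assms(1) by (simp add: normal_linear_model_def)
  have "(AE w in M. P (Y w)) \<longleftrightarrow> (AE y in distr M lborel Y. P y)"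
    using assms(3) distributed_measurable[OF D] by (subst AE_distr_iff) auto
  also have "\<dots> \<longleftrightarrow> (AE y in density lborel ?f. P y)"
    unfolding distributed_distr_eq_density[OF D] ..
  also have "\<dots> \<longleftrightarrow> (AE y in lborel. P y)"
    using distributed_borel_measurable[OF D]
    by (subst AE_density) (simp_all add: mvnormal_density_pos[OF assms(2)])
  finally show ?thesis by (simp add: AE_lborel_closed_iff[OF assms(3)])
qed

section \<open>Orthogonality through a set of factors\<close>

lemma column_joint_design:
  "column (B, t) (joint_design run T) = (if B \<in> T then column t (design run B) else 0)"
  by (simp add: column_def joint_design_def vec_eq_iff)

text \<open>
  A product vanishes exactly if the left factor annihilates each column of the right one, and the
  nonzero columns of the joint matrix are the nonzero columns of the designs of the factors in \<open>T\<close>.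
\<close>

lemma mult_joint_design_eq_0_iff:
  fixes L :: "real^'n^'m"
  shows "L ** joint_design run T = 0 \<longleftrightarrow> (\<forall>B\<in>T. L ** design run B = 0)"
proof -
  have mult_0: "L ** Z = 0 \<longleftrightarrow> (\<forall>t. L *v column t Z = 0)" for Z :: "real^'k^'n"
    by (auto simp: vec_eq_iff matrix_matrix_mult_def matrix_vector_mult_def column_def)
  show ?thesis
    unfolding mult_0 by (auto simp: column_joint_design)
qed

lemma span_columns_joint_design_mono:
  assumes "T \<subseteq> U"
  shows "span (columns (joint_design run T)) \<subseteq> span (columns (joint_design run U))"
proof (rule span_minimal)
  show "columns (joint_design run T) \<subseteq> span (columns (joint_design run U))"
  proof
    fix x assume "x \<in> columns (joint_design run T)"
    then obtain B t where x: "x = column (B, t) (joint_design run T)"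
      by (auto simp: columns_def)
    show "x \<in> span (columns (joint_design run U))"
    proof (cases "B \<in> T")
      case True
      then have "x = column (B, t) (joint_design run U)"
        using assms by (auto simp: x column_joint_design)
      then show ?thesis by (auto simp: columns_def intro: span_base)
    next
      case False
      then show ?thesis by (simp add: x column_joint_design span_zero)
    qed
  qed
qed simp

text \<open>
  The factors in \<open>T\<close> can be added to those in \<open>S\<close> for free, because \<open>I - P\<^sub>T\<close> annihilates their
  design matrices. This turns the condition into one about the full set of adjusting factors.
\<close>

lemma orthogonal_through_all_iff:
  "(\<forall>B\<in>S. orthogonal_through run A T B) \<longleftrightarrow>
   transpose (design run A) ** residual_maker (joint_design run T) ** joint_design run (S \<union> T) = 0"
proof -
  let ?L = "transpose (design run A) ** residual_maker (joint_design run T)"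
  have "?L ** joint_design run T = 0"
    by (simp add: matrix_mul_assoc[symmetric] residual_maker_mult_self)
  then have "\<forall>B\<in>T. ?L ** design run B = 0"
    by (simp add: mult_joint_design_eq_0_iff)
  then show ?thesis
    by (auto simp: mult_joint_design_eq_0_iff orthogonal_through_def residual_maker_def)
qed

text \<open>
  For the implication from left to right, the responses tested are those in the column space of
  the joint design matrix of \<open>U\<close>: adjustment for \<open>U\<close> leaves nothing of them, so both sums of
  squares are zero, and then \<open>Q_adj\<close> with respect to \<open>T\<close> is zero too.
\<close>

lemma SS_adj_eq_iff:
  assumes "T \<subseteq> U"
  shows "(\<forall>y. SS_adj run A U y = SS_adj run A T y) \<longleftrightarrow>
         residual_maker (joint_design run U) ** design run A =
         residual_maker (joint_design run T) ** design run A"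
proof
  assume eq: "\<forall>y. SS_adj run A U y = SS_adj run A T y"
  let ?N = "joint_design run T" and ?N' = "joint_design run U"
  have "Q_adj run A T (?N' *v x) = 0" for x
  proof (rule SS_adj_eq_0_imp)
    have "Q_adj run A U (?N' *v x) = 0"
      by (simp add: Q_adj_def residual_maker_def[symmetric] matrix_vector_mul_assoc[symmetric]
          residual_columnspace matrix_vector_mult_in_columnspace del: transpose_matrix_vector)
    then show "SS_adj run A T (?N' *v x) = 0"
      using eq by (metis SS_adj_def inner_zero_left)
  qed
  then have "transpose (design run A) ** residual_maker ?N ** ?N' = 0"
    by (simp add: matrix_eq Q_adj_def residual_maker_def matrix_vector_mul_assoc)
  then show "residual_maker ?N' ** design run A = residual_maker ?N ** design run A"
    using cross_residual_zero_iff_residual_eq span_columns_joint_design_mono[OF assms] by blast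
qed (simp add: SS_adj_eq_norm_sq)

theorem theorem3p1:
  fixes lev :: "'f::finite \<Rightarrow> 'l::finite set"
    and run :: "'n::finite \<Rightarrow> 'f \<Rightarrow> 'l"
    and G A :: 'f
    and S T :: "'f set"
    and \<alpha> :: "'f \<Rightarrow> real^'l"
    and \<sigma> :: real
    and M :: "'w measure"
    and Y :: "'w \<Rightarrow> real^'n"
  assumes "main_effect_plan lev run G"
    and "connected_plan lev run"
    and "\<sigma> > 0"
    and "normal_linear_model run \<alpha> \<sigma> M Y"
    and "- {A} = S \<union> T"
    and "S \<inter> T = {}"
  shows "((\<forall>B\<in>S. orthogonal_through run A T B) \<longleftrightarrow> C_matrix run A = C_adj run A T) \<and>
         ((\<forall>B\<in>S. orthogonal_through run A T B) \<longleftrightarrow>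
            (AE w in M. SS_adj run A (- {A}) (Y w) = SS_adj run A T (Y w)))"
proof -
  have sub: "T \<subseteq> - {A}" using assms(5) by blast
  have "closed {y. SS_adj run A (- {A}) y = SS_adj run A T y}"
    by (intro closed_Collect_eq continuous_SS_adj)
  then have ae: "(AE w in M. SS_adj run A (- {A}) (Y w) = SS_adj run A T (Y w)) \<longleftrightarrow>
      (\<forall>y. SS_adj run A (- {A}) y = SS_adj run A T y)"
    by (rule normal_linear_model_AE_iff[OF assms(4,3)])
  have orth: "(\<forall>B\<in>S. orthogonal_through run A T B) \<longleftrightarrow>
      residual_maker (joint_design run (- {A})) ** design run A =
      residual_maker (joint_design run T) ** design run A"
    unfolding orthogonal_through_all_iff assms(5)[symmetric]
    by (rule cross_residual_zero_iff_residual_eq[OF span_columns_joint_design_mono[OF sub]])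
  show ?thesis
    unfolding ae orth SS_adj_eq_iff[OF sub] C_matrix_def C_adj_residual
      gram_residual_eq_iff[OF span_columns_joint_design_mono[OF sub]]
    by simp
qed

end
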